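(* Let $\Theta_0\subseteq\Theta$ be non-empty and suppose that $D:=\sup_{\theta_1,\theta_2\in\Theta_0}d(\theta_1,\theta_2)$ is finite and satisfies $g(D)>0$. Let $\Delta\in[0,\infty)$ be such that $$\inf_{\hat\theta\in\hat\Theta}\sup_{\theta_0\in\Theta_0}\sup_{P_{\theta_0}\in\mathcal{P}_{\theta_0}}\mathbb{E}_{P_{\theta_0}}L(\hat\theta,\theta_0)\ge\Delta.$$ Then for every $\epsilon>0$ and every $\delta\in\Bigl(0,\frac{\Delta-g(\epsilon D)}{g((1+\epsilon)D)}\Bigr)$, we have $\mathcal{M}_-(\delta)\ge g(\epsilon D)$.
   Context: Setting: $(\Theta,d)$ is a non-empty pseudo-metric space (i.e. $d:\Theta\times\Theta\to[0,\infty)$ is symmetric, satisfies $d(\theta,\theta)=0$ and the triangle inequality, but $d(\theta_1,\theta_2)=0$ is allowed for $\theta_1\ne\theta_2$), equipped with the topology induced by the open balls of $d$ and the corresponding Borel $\sigma$-algebra. For each $\theta\in\Theta$, $\mathcal{P}_\theta$ is a family of probability measures on a measurable space $(\mathcal{X},\mathcal{A})$, and $\mathcal{P}_\Theta:=\{\mathcal{P}_\theta:\theta\in\Theta\}$. The function $g:[0,\infty)\to[0,\infty)$ is increasing (non-decreasing) and the loss is $L(\theta_1,\theta_2):=g(d(\theta_1,\theta_2))$. $\hat\Theta$ is the set of all measurable functions (estimators) from $\mathcal{X}$ to $\Theta$. Lower minimax $(1-\delta)$th quantile: $\mathcal{M}_-(\delta):=\inf\{r\in[0,\infty):\inf_{\hat\theta\in\hat\Theta}\sup_{\theta\in\Theta}\sup_{P_\theta\in\mathcal{P}_\theta}P_\theta\{L(\hat\theta,\theta)>r\}\le\delta\}$.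 The interval for $\delta$ is empty when its right endpoint is not positive. *)

theory Defs
  imports "HOL-Probability.Probability"
begin

definition pseudo_metric_on :: "'a set \<Rightarrow> ('a \<Rightarrow> 'a \<Rightarrow> real) \<Rightarrow> bool" where
  "pseudo_metric_on \<Theta> d \<longleftrightarrow>
     (\<forall>s\<in>\<Theta>. \<forall>t\<in>\<Theta>. 0 \<le> d s t) \<and>
     (\<forall>s\<in>\<Theta>. d s s = 0) \<and>
     (\<forall>s\<in>\<Theta>. \<forall>t\<in>\<Theta>. d s t = d t s) \<and>
     (\<forall>s\<in>\<Theta>. \<forall>t\<in>\<Theta>. \<forall>u\<in>\<Theta>. d s u \<le> d s t + d t u)"

definition pseudo_topology :: "'a set \<Rightarrow> ('a \<Rightarrow> 'a \<Rightarrow> real) \<Rightarrow> 'a topology" where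
  "pseudo_topology \<Theta> d =
     topology_generated_by {{s \<in> \<Theta>. d t s < r} | t r. t \<in> \<Theta> \<and> 0 < r}"

definition pseudo_borel :: "'a set \<Rightarrow> ('a \<Rightarrow> 'a \<Rightarrow> real) \<Rightarrow> 'a measure" where
  "pseudo_borel \<Theta> d = sigma \<Theta> {U. openin (pseudo_topology \<Theta> d) U}"

definition estimators ::
    "'x measure \<Rightarrow> 'a set \<Rightarrow> ('a \<Rightarrow> 'a \<Rightarrow> real) \<Rightarrow> ('x \<Rightarrow> 'a) set" where
  "estimators X \<Theta> d = measurable X (pseudo_borel \<Theta> d)"

definition loss :: "(real \<Rightarrow> real) \<Rightarrow> ('a \<Rightarrow> 'a \<Rightarrow> real) \<Rightarrow> 'a \<Rightarrow> 'a \<Rightarrow> real" where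
  "loss g d s t = g (d s t)"

text \<open>The quantile lives in \<open>[0,\<infinity>]\<close>, so that it is \<open>\<infinity>\<close> when no finite radius
  qualifies; suprema over an empty family \<open>\<P> \<theta>\<close> are \<open>0\<close>.\<close>

definition lower_minimax_quantile ::
    "'x measure \<Rightarrow> 'a set \<Rightarrow> ('a \<Rightarrow> 'a \<Rightarrow> real) \<Rightarrow> ('a \<Rightarrow> 'x measure set) \<Rightarrow>
     (real \<Rightarrow> real) \<Rightarrow> real \<Rightarrow> ennreal" where
  "lower_minimax_quantile X \<Theta> d \<P> g \<delta> =
     Inf (ennreal ` {r. 0 \<le> r \<and>
       (INF h\<in>estimators X \<Theta> d. SUP \<theta>\<in>\<Theta>. SUP P\<in>\<P> \<theta>.
          emeasure P {x \<in> space X. loss g d (h x) \<theta> > r}) \<le> ennreal \<delta>})"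

lemma topspace_pseudo_topology:
  assumes "pseudo_metric_on \<Theta> d"
  shows "topspace (pseudo_topology \<Theta> d) = \<Theta>"
proof -
  have "t \<in> {s \<in> \<Theta>. d t s < 1}" if "t \<in> \<Theta>" for t
    using assms that by (simp add: pseudo_metric_on_def)
  moreover have "(0::real) < 1" by simp
  ultimately show ?thesis
    unfolding pseudo_topology_def topology_generated_by_topspace by blast
qed

end

theory Submission
  imports Defs
begin

text \<open>Argue by contradiction: let \<open>h\<close> be an estimator whose loss exceeds some
  \<open>r < g (\<epsilon> D)\<close> with small probability, uniformly over the parameters. Replace \<open>h\<close> by a fixed
  point of \<open>\<Theta>0\<close> wherever \<open>h x\<close> is at distance at least \<open>\<epsilon> D\<close> from \<open>\<Theta>0\<close>. The loss of the new
  estimator on \<open>\<Theta>0\<close> never exceeds \<open>g ((1 + \<epsilon>) D)\<close>, and it is at most \<open>r\<close> wherever that of \<open>h\<close>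
  is, since such points are not modified. This bounds its expected loss below \<open>\<Delta>\<close>.\<close>

lemma space_pseudo_borel [simp]: "space (pseudo_borel \<Theta> d) = \<Theta>"
  by (simp add: pseudo_borel_def space_measure_of_conv)

lemma pseudo_borel_open:
  assumes "pseudo_metric_on \<Theta> d" and "openin (pseudo_topology \<Theta> d) U"
  shows "U \<in> sets (pseudo_borel \<Theta> d)"
proof -
  have "{U. openin (pseudo_topology \<Theta> d) U} \<subseteq> Pow \<Theta>"
    using openin_subset topspace_pseudo_topology[OF assms(1)] by fastforce
  then show ?thesis
    using assms(2) by (simp add: pseudo_borel_def)
qed

text \<open>Symmetry moves the centre to the second argument, where the loss has the parameter. No
  sign condition is put on \<open>r\<close>, since Borel measurability of the distance needs its
  sublevel sets at every real level; for \<open>r \<le> 0\<close> they are empty.\<close>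

lemma openin_pseudo_ball:
  assumes "pseudo_metric_on \<Theta> d" and "t \<in> \<Theta>"
  shows "openin (pseudo_topology \<Theta> d) {s \<in> \<Theta>. d s t < r}"
proof (cases "0 < r")
  case True
  have eq: "{s \<in> \<Theta>. d s t < r} = {s \<in> \<Theta>. d t s < r}"
    using assms by (auto simp: pseudo_metric_on_def)
  show ?thesis
    unfolding eq pseudo_topology_def
    by (rule topology_generated_by_Basis) (use True assms(2) in blast)
next
  case False
  then have "{s \<in> \<Theta>. d s t < r} = {}"
    using assms by (fastforce simp: pseudo_metric_on_def)
  then show ?thesis by (simp only: openin_empty)
qed

lemma measurable_pseudo_dist:
  assumes "pseudo_metric_on \<Theta> d" and "t \<in> \<Theta>"
  shows "(\<lambda>s. d s t) \<in> borel_measurable (pseudo_borel \<Theta> d)"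
  unfolding borel_measurable_iff_less
  using pseudo_borel_open[OF assms(1) openin_pseudo_ball[OF assms]] by simp

lemma estimator_in:
  assumes "h \<in> estimators X \<Theta> d" and "x \<in> space X"
  shows "h x \<in> \<Theta>"
  using measurable_space[of h X "pseudo_borel \<Theta> d" x] assms by (simp add: estimators_def)

lemma measurable_loss:
  assumes "pseudo_metric_on \<Theta> d" and "t \<in> \<Theta>" and "mono_on {0..} g"
    and "h \<in> estimators X \<Theta> d"
  shows "(\<lambda>x. loss g d (h x) t) \<in> borel_measurable X"
proof -
  have [measurable]: "h \<in> measurable X (pseudo_borel \<Theta> d)"
    using assms(4) by (simp add: estimators_def)
  \<comment> \<open>\<open>g\<close> is monotone only on the nonnegative reals. Clamping its
    argument at \<open>0\<close> gives a globally monotone, hence Borel, function that agrees with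
    \<open>g\<close> on distances.\<close>
  have "mono (\<lambda>y. g (max 0 y))"
    using assms(3) by (auto simp: mono_def mono_on_def max_def)
  then have [measurable]: "(\<lambda>y. g (max 0 y)) \<in> borel_measurable borel"
    by (rule borel_measurable_mono)
  have [measurable]: "(\<lambda>s. d s t) \<in> borel_measurable (pseudo_borel \<Theta> d)"
    by (rule measurable_pseudo_dist[OF assms(1,2)])
  have "(\<lambda>x. g (max 0 (d (h x) t))) \<in> borel_measurable X"
    by measurable
  moreover have "loss g d (h x) t = g (max 0 (d (h x) t))" if "x \<in> space X" for x
  proof -
    have "h x \<in> \<Theta>"
      by (rule estimator_in[OF assms(4) that])
    then show ?thesis
      using assms(1,2) by (simp add: pseudo_metric_on_def loss_def max_def)
  qed
  ultimately show ?thesis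
    by (subst measurable_cong[where g = "\<lambda>x. g (max 0 (d (h x) t))"])
qed

text \<open>The points at distance strictly less than \<open>e\<close> from \<open>S\<close> form a
  union of open balls, hence an open set even for uncountable \<open>S\<close>. The case distinction
  is therefore on a measurable event.\<close>

lemma truncated_estimator:
  assumes pm: "pseudo_metric_on \<Theta> d" and h: "h \<in> estimators X \<Theta> d"
    and sub: "S \<subseteq> \<Theta>" and c: "c \<in> \<Theta>"
  shows "(\<lambda>x. if \<exists>t\<in>S. d (h x) t < e then h x else c) \<in> estimators X \<Theta> d"
proof -
  have hm [measurable]: "h \<in> measurable X (pseudo_borel \<Theta> d)"
    using h by (simp add: estimators_def)
  define U where "U = (\<Union>t\<in>S. {s \<in> \<Theta>. d s t < e})"
  have "openin (pseudo_topology \<Theta> d) U"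
    unfolding U_def using openin_pseudo_ball[OF pm] sub by blast
  then have [measurable]: "U \<in> sets (pseudo_borel \<Theta> d)"
    by (rule pseudo_borel_open[OF pm])
  have "{x \<in> space X. h x \<in> U} \<in> sets X"
    by measurable
  then have "(\<lambda>x. if h x \<in> U then h x else c) \<in> measurable X (pseudo_borel \<Theta> d)"
    using c by (intro measurable_If hm) simp_all
  moreover have "h x \<in> U \<longleftrightarrow> (\<exists>t\<in>S. d (h x) t < e)" if "x \<in> space X" for x
    using estimator_in[OF h that] by (auto simp: U_def)
  ultimately show ?thesis
    unfolding estimators_def
    by (subst measurable_cong[where g = "\<lambda>x. if h x \<in> U then h x else c"]) simp_all
qed

text \<open>Integrate the pointwise bound of \<open>f\<close> by \<open>a + b * indicator B\<close>,
  using that \<open>P\<close> has total mass one.\<close>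

lemma nn_integral_le_of_bad_event:
  assumes "prob_space P" and "B \<in> sets P" and "0 \<le> a" and "0 \<le> b"
    and "\<And>x. x \<in> space P \<Longrightarrow> f x \<le> b"
    and "\<And>x. x \<in> space P \<Longrightarrow> x \<notin> B \<Longrightarrow> f x \<le> a"
  shows "(\<integral>\<^sup>+ x. ennreal (f x) \<partial>P) \<le> ennreal a + ennreal b * emeasure P B"
proof -
  interpret prob_space P by fact
  have "(\<integral>\<^sup>+ x. ennreal (f x) \<partial>P) \<le> (\<integral>\<^sup>+ x. ennreal a + ennreal b * indicator B x \<partial>P)"
  proof (rule nn_integral_mono)
    fix x assume x: "x \<in> space P"
    show "ennreal (f x) \<le> ennreal a + ennreal b * indicator B x"
    proof (cases "x \<in> B")
      case True
      have "ennreal (f x) \<le> ennreal b"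
        using assms(5)[OF x] by (rule ennreal_leI)
      also have "\<dots> \<le> ennreal a + ennreal b"
        by simp
      finally show ?thesis using True by simp
    qed (use assms(6)[OF x] in \<open>simp add: ennreal_leI\<close>)
  qed
  also have "\<dots> = ennreal a + ennreal b * emeasure P B"
    using assms(2) by (simp add: nn_integral_add nn_integral_cmult_indicator emeasure_space_1)
  finally show ?thesis .
qed

theorem theorem8:
  fixes \<Theta> \<Theta>0 :: "'a set" and d :: "'a \<Rightarrow> 'a \<Rightarrow> real"
    and X :: "'x measure" and \<P> :: "'a \<Rightarrow> 'x measure set"
    and g :: "real \<Rightarrow> real" and D \<Delta> \<epsilon> \<delta> :: real
  assumes "\<Theta> \<noteq> {}" and "pseudo_metric_on \<Theta> d"
    and "\<And>\<theta> P. \<theta> \<in> \<Theta> \<Longrightarrow> P \<in> \<P> \<theta> \<Longrightarrow> prob_space P \<and> sets P = sets X"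
    and "mono_on {0..} g" and "\<And>x. 0 \<le> x \<Longrightarrow> 0 \<le> g x"
    and "\<Theta>0 \<subseteq> \<Theta>" and "\<Theta>0 \<noteq> {}"
    and "bdd_above ((\<lambda>(s, t). d s t) ` (\<Theta>0 \<times> \<Theta>0))"
    and "D = (SUP (s, t)\<in>\<Theta>0 \<times> \<Theta>0. d s t)"
    and "0 < g D"
    and "0 \<le> \<Delta>"
    and "(INF h\<in>estimators X \<Theta> d. SUP \<theta>\<in>\<Theta>0. SUP P\<in>\<P> \<theta>.
            \<integral>\<^sup>+ x. ennreal (loss g d (h x) \<theta>) \<partial>P) \<ge> ennreal \<Delta>"
    and "0 < \<epsilon>"
    and "\<delta> \<in> {0 <..< (\<Delta> - g (\<epsilon> * D)) / g ((1 + \<epsilon>) * D)}"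
  shows "lower_minimax_quantile X \<Theta> d \<P> g \<delta> \<ge> ennreal (g (\<epsilon> * D))"
proof (rule ccontr)
  note pm = assms(2) and mono = assms(4) and g_nonneg = assms(5) and sub = assms(6)
  define G where "G = g ((1 + \<epsilon>) * D)"
  have dle: "d s t \<le> D" if "s \<in> \<Theta>0" "t \<in> \<Theta>0" for s t
    unfolding assms(9) using that assms(8) by (force intro: cSUP_upper2[where x = "(s, t)"])
  obtain c where c: "c \<in> \<Theta>0" using assms(7) by blast
  have D: "0 \<le> D"
    using dle[OF c c] c sub pm by (auto simp: pseudo_metric_on_def)
  have eD: "0 \<le> \<epsilon> * D" using D assms(13) by simp
  have gD: "g y \<le> g z" if "0 \<le> y" "y \<le> z" for y z
    using mono that by (auto simp: mono_on_def)
  \<comment> \<open>Monotonicity along \<open>D \<le> (1 + \<epsilon>) * D\<close> gives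
    \<open>g D \<le> G\<close>.\<close>
  have G: "0 < G"
    using gD[OF D, of "(1 + \<epsilon>) * D"] eD assms(10) by (simp add: G_def algebra_simps)
  have ge: "0 \<le> g (\<epsilon> * D)" by (rule g_nonneg[OF eD])
  have "0 < \<delta>" "\<delta> < (\<Delta> - g (\<epsilon> * D)) / G" using assms(14) by (auto simp: G_def)
  \<comment> \<open>The infimum over estimators may equal \<open>\<delta>\<close> without being
    attained. The slack up to \<open>\<delta>'\<close> yields an actual estimator
    \<open>h\<close>.\<close>
  obtain \<delta>' where \<delta>': "\<delta> < \<delta>'" "\<delta>' < (\<Delta> - g (\<epsilon> * D)) / G"
    using dense[OF \<open>\<delta> < (\<Delta> - g (\<epsilon> * D)) / G\<close>] by blast
  then have pos: "0 < \<delta>'" using \<open>0 < \<delta>\<close> by simp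
  assume "\<not> ?thesis"
  then obtain r where r: "0 \<le> r" "ennreal r < ennreal (g (\<epsilon> * D))"
    and inf: "(INF h\<in>estimators X \<Theta> d. SUP \<theta>\<in>\<Theta>. SUP P\<in>\<P> \<theta>.
          emeasure P {x \<in> space X. loss g d (h x) \<theta> > r}) \<le> ennreal \<delta>"
    unfolding lower_minimax_quantile_def not_le Inf_less_iff by blast
  from inf have "(INF h\<in>estimators X \<Theta> d. SUP \<theta>\<in>\<Theta>. SUP P\<in>\<P> \<theta>.
          emeasure P {x \<in> space X. loss g d (h x) \<theta> > r}) < ennreal \<delta>'"
    using \<delta>'(1) \<open>0 < \<delta>\<close> by (simp add: order_le_less_trans ennreal_lessI)
  then obtain h where h: "h \<in> estimators X \<Theta> d"
    and hb: "(SUP \<theta>\<in>\<Theta>. SUP P\<in>\<P> \<theta>. emeasure P {x \<in> space X. loss g d (h x) \<theta> > r}) < ennreal \<delta>'"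
    unfolding INF_less_iff by blast
  have bad: "emeasure P {x \<in> space X. loss g d (h x) \<theta> > r} \<le> ennreal \<delta>'"
    if "\<theta> \<in> \<Theta>" "P \<in> \<P> \<theta>" for \<theta> P
    using that by (intro order_trans[OF _ less_imp_le[OF hb]] SUP_upper2[OF that(1)] SUP_upper)
  define h' where "h' x = (if \<exists>t\<in>\<Theta>0. d (h x) t < \<epsilon> * D then h x else c)" for x
  have h': "h' \<in> estimators X \<Theta> d"
    unfolding h'_def using truncated_estimator[OF pm h sub] c sub by blast
  have risk: "(\<integral>\<^sup>+ x. ennreal (loss g d (h' x) \<theta>) \<partial>P) \<le> ennreal (g (\<epsilon> * D)) + ennreal G * ennreal \<delta>'"
    if \<theta>: "\<theta> \<in> \<Theta>0" and P: "P \<in> \<P> \<theta>" for \<theta> P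
  proof -
    have \<theta>': "\<theta> \<in> \<Theta>" using \<theta> sub by blast
    have prob: "prob_space P" and sets: "sets P = sets X"
      using assms(3)[OF \<theta>' P] by auto
    have space: "space P = space X" using sets by (rule sets_eq_imp_space_eq)
    define B where "B = {x \<in> space X. loss g d (h x) \<theta> > r}"
    have [measurable]: "(\<lambda>x. loss g d (h x) \<theta>) \<in> borel_measurable X"
      by (rule measurable_loss[OF pm \<theta>' mono h])
    have B: "B \<in> sets P" unfolding sets B_def by measurable
    have "(\<integral>\<^sup>+ x. ennreal (loss g d (h' x) \<theta>) \<partial>P) \<le> ennreal (g (\<epsilon> * D)) + ennreal G * emeasure P B"
    proof (rule nn_integral_le_of_bad_event[OF prob B ge less_imp_le[OF G]])
      fix x assume "x \<in> space P"
      then have x: "x \<in> space X" by (simp add: space)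
      have nn: "0 \<le> d (k x) \<theta>" if "k \<in> estimators X \<Theta> d" for k
        using pm estimator_in[OF that x] \<theta>' by (simp add: pseudo_metric_on_def)
      \<comment> \<open>A kept value lies within \<open>\<epsilon> * D\<close> of some
        \<open>t\<close> in \<open>\<Theta>0\<close>, and \<open>t\<close> within \<open>D\<close>
        of \<open>\<theta>\<close>; a replaced value is \<open>c\<close>, itself within
        \<open>D\<close> of \<open>\<theta>\<close>.\<close>
      have "d (h' x) \<theta> \<le> (1 + \<epsilon>) * D"
      proof (cases "\<exists>t\<in>\<Theta>0. d (h x) t < \<epsilon> * D")
        case True
        then obtain t where t: "t \<in> \<Theta>0" "d (h x) t < \<epsilon> * D" by blast
        have "d (h x) \<theta> \<le> d (h x) t + d t \<theta>"
          using pm estimator_in[OF h x] \<theta>' t(1) sub unfolding pseudo_metric_on_def by blast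
        also have "\<dots> \<le> \<epsilon> * D + D"
          using t dle[OF t(1) \<theta>] by linarith
        finally show ?thesis using True by (simp add: h'_def algebra_simps)
      next
        case False
        then show ?thesis using dle[OF c \<theta>] eD by (simp add: h'_def algebra_simps)
      qed
      then show "loss g d (h' x) \<theta> \<le> G"
        unfolding loss_def G_def by (rule gD[OF nn[OF h']])
      assume "x \<notin> B"
      then have le: "g (d (h x) \<theta>) \<le> r" using x by (simp add: B_def loss_def)
      have rg: "r < g (\<epsilon> * D)" using r by (simp add: ennreal_less_iff)
      \<comment> \<open>Otherwise monotonicity would force a loss of at least
        \<open>g (\<epsilon> * D) > r\<close>. So \<open>\<theta>\<close> itself witnesses that
        \<open>h x\<close> is kept. If \<open>D = 0\<close>, no value is kept, but then
        \<open>B\<close> is all of \<open>space X\<close>.\<close>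
      have "d (h x) \<theta> < \<epsilon> * D"
        using gD[OF eD, of "d (h x) \<theta>"] le rg by linarith
      then have "h' x = h x" using \<theta> by (auto simp: h'_def)
      then show "loss g d (h' x) \<theta> \<le> g (\<epsilon> * D)"
        using le rg by (simp add: loss_def)
    qed
    also have "\<dots> \<le> ennreal (g (\<epsilon> * D)) + ennreal G * ennreal \<delta>'"
      using bad[OF \<theta>' P] unfolding B_def by (intro add_left_mono mult_left_mono) auto
    finally show ?thesis .
  qed
  \<comment> \<open>The lower bound on the minimax risk applies to \<open>h'\<close>, whereas the
    choice of \<open>\<delta>'\<close> says exactly that
    \<open>g (\<epsilon> * D) + G * \<delta>' < \<Delta>\<close>.\<close>
  have "ennreal \<Delta> \<le> (SUP \<theta>\<in>\<Theta>0. SUP P\<in>\<P> \<theta>. \<integral>\<^sup>+ x. ennreal (loss g d (h' x) \<theta>) \<partial>P)"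
    using assms(12) by (rule order_trans) (rule INF_lower[OF h'])
  also have "\<dots> \<le> ennreal (g (\<epsilon> * D)) + ennreal G * ennreal \<delta>'"
    by (intro SUP_least risk)
  also have "\<dots> = ennreal (g (\<epsilon> * D) + G * \<delta>')"
    using G ge pos by (simp add: ennreal_mult)
  finally have "\<Delta> \<le> g (\<epsilon> * D) + G * \<delta>'"
    using G ge pos by (subst (asm) ennreal_le_iff) simp_all
  then show False
    using \<delta>'(2) G by (simp add: field_simps)
qed

end
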